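(* Let $X_\sigma$ be a three-dimensional affine toric Gorenstein singularity given by a lattice polygon $P$ with edges $d_1,\dots,d_N$, over a field $k$ of characteristic $0$, and let $\underline t,\underline s\in V$. (1) If all edges of $P$ have lattice length $1$ (i.e. $X_\sigma$ is an isolated singularity), then $\underline t\cup\underline s=0$ if and only if $d_1t_1s_1+\cdots+d_Nt_Ns_N=0$. (2) Suppose $P$ has one edge $d_j$ with $\ell(d_j)>1$, and for all other edges $d_k$ it holds that either $\ell(d_k)=1$ for all $k\neq j$, or there exists $d_i$ parallel to $d_j$ with $\ell(d_i)>1$. In this case $\underline t\cup\underline s=0$ if and only if $d_1t_1s_1+\cdots+d_Nt_Ns_N=0$ on $a_j^\perp\cap a_{j+1}^\perp=a_i^\perp\cap a_{i+1}^\perp$. (3) If $P$ has at least two non-parallel edges that have lattice length $\ge 2$, then $\underline t\cup\underline s=0$ always holds.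
   Context: $k$ is a field of characteristic $0$; $M,N$ are mutually dual free abelian groups of rank $3$ (the letter $N$ also denotes the number of vertices below), $N_k=N\otimes_{\mathbb Z}k$, $M_k=M\otimes_{\mathbb Z}k$, with pairing $\langle\cdot,\cdot\rangle$. $P$ is a lattice polygon in $\mathbb R^2\times\{1\}\subset\mathbb R^3=N_{\mathbb R}$, $\sigma=\operatorname{Cone}(P)=\langle a_1,\dots,a_N\rangle$ with $a_1,\dots,a_N$ the vertices of $P$ arranged in a cycle, $a_{N+1}:=a_1$, $\Lambda=\sigma^\vee\cap M$, $X_\sigma=\operatorname{Spec}(k[\Lambda])$, $R^*=(0,0,1)\in M$. Put $d_j:=a_{j+1}-a_j$, $\ell(d_j)$ its lattice length, and $V=\{\underline t\in k^N\mid\sum_{j=1}^Nt_jd_j=0\}$. Elements of $N_k$ are regarded as linear functions on $M_k$; $a_j^\perp=\{r\in M_k\mid\langle a_j,r\rangle=0\}$. For $j=1,\dots,N$ let $K^{2R^*}_{a_j}=\{r\in\Lambda\mid\langle a_j,r\rangle<2\}$ and let $\delta_j=0$ if $\ell(d_j)<2$, $\delta_j=1$ if $\ell(d_j)\ge2$. Consider the complex $$N_k^N\xrightarrow{\ \delta\ }\bigoplus_{j=1}^N N_k/(k\,\delta_jd_j)\xrightarrow{\ \eta\ }\Big(\operatorname{span}_k\big(\textstyle\bigcap_jK^{2R^*}_{a_j}\big)\Big)^*,$$ $\delta(b_1,\dots,b_N)=(b_1-b_2,b_2-b_3,\dots,b_N-b_1)$, $\eta(q_1,\dots,q_N)=\sum_jq_j$.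 The cup product of $\underline t,\underline s\in V$ is the element $$\underline t\cup\underline s:=\overline{(s_1t_1d_1,\dots,s_Nt_Nd_N)}\in\ker\eta/\operatorname{im}\delta.$$ (Under the isomorphisms $T^1(-R^* )\cong V/(k\cdot(1,\dots,1))$ and $T^2(-2R^* )\cong\ker\eta/\operatorname{im}\delta$ of degree parts of André–Quillen cohomology of $k[\Lambda]$, this represents the cup product $T^1(-R^* )\times T^1(-R^* )\to T^2(-2R^* )$.)
   Formalization: In (2) the equality of the two intersections of perps, false as lines in M_k, is replaced by equality after adding k·R^*, with the criterion proved on each line; in the parallel case all edges other than d_i, d_j are taken to have lattice length 1. *)

theory Defs
  imports "HOL-Analysis.Analysis" "HOL-Algebra.Product_Groups"
begin

text \<open>
  The lattices \<open>N\<close> and \<open>M\<close> are both \<open>int^3\<close>, and for a field \<open>k\<close> the extensions \<open>N\<^sub>k\<close>, \<open>M\<^sub>k\<close> are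
  \<open>k^3\<close>; over every ring the pairing is \<open>scalar_product\<close>.
\<close>

definition base_change :: "int^3 \<Rightarrow> 'r::ring_1^3" where
  "base_change v = (\<chi> i. of_int (v $ i))"

definition lattice_polygon :: "(real^3) set \<Rightarrow> bool" where
  "lattice_polygon P \<longleftrightarrow>
     (\<exists>S :: (int^3) set. finite S \<and> (\<forall>v\<in>S. v $ 3 = 1) \<and> P = convex hull (base_change ` S)) \<and>
     aff_dim P = 2"

text \<open>Indices \<open>1,\<dots>,n\<close> are read cyclically.\<close>

definition next_index :: "nat \<Rightarrow> nat \<Rightarrow> nat" where
  "next_index n j = (if j = n then 1 else Suc j)"

definition cyclic_vertices :: "(real^3) set \<Rightarrow> nat \<Rightarrow> (nat \<Rightarrow> int^3) \<Rightarrow> bool" where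
  "cyclic_vertices P n a \<longleftrightarrow>
     bij_betw (\<lambda>j. base_change (a j)) {1..n} {v. v extreme_point_of P} \<and>
     (\<forall>j\<in>{1..n}. closed_segment (base_change (a j)) (base_change (a (next_index n j))) edge_of P)"

definition edge :: "nat \<Rightarrow> (nat \<Rightarrow> int^3) \<Rightarrow> nat \<Rightarrow> int^3" where
  "edge n a j = a (next_index n j) - a j"

definition lattice_length :: "int^3 \<Rightarrow> nat" where
  "lattice_length d = nat (Gcd (range (\<lambda>i. d $ i)))"

definition parallel :: "int^3 \<Rightarrow> int^3 \<Rightarrow> bool" where
  "parallel d e \<longleftrightarrow> collinear {0, base_change d :: real^3, base_change e}"

definition V_space :: "nat \<Rightarrow> (nat \<Rightarrow> int^3) \<Rightarrow> (nat \<Rightarrow> 'k::field_char_0) set" where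
  "V_space n a = {t \<in> {1..n} \<rightarrow>\<^sub>E UNIV. (\<Sum>j=1..n. t j *s base_change (edge n a j)) = 0}"

definition dual_semigroup :: "(real^3) set \<Rightarrow> (int^3) set" where
  "dual_semigroup P = {r. \<forall>x \<in> cone hull P. scalar_product x (base_change r) \<ge> 0}"

text \<open>\<open>K_set P v\<close> is \<open>K\<close> in degree \<open>2R\<^sup>*\<close>: every \<open>v\<close> of height 1 has \<open>\<langle>v, 2R\<^sup>*\<rangle> = 2\<close>.\<close>

definition K_set :: "(real^3) set \<Rightarrow> int^3 \<Rightarrow> (int^3) set" where
  "K_set P v = {r \<in> dual_semigroup P. scalar_product v r < 2}"

definition K_span :: "(real^3) set \<Rightarrow> nat \<Rightarrow> (nat \<Rightarrow> int^3) \<Rightarrow> ('k::field_char_0^3) set" where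
  "K_span P n a = vec.span (base_change ` (\<Inter>j\<in>{1..n}. K_set P (a j)))"

definition vector_group :: "('k::field_char_0^3) monoid" where
  "vector_group = \<lparr>carrier = UNIV, monoid.mult = (+), one = 0\<rparr>"

definition dual_group :: "('k::field_char_0^3) set \<Rightarrow> ('k^3 \<Rightarrow> 'k) monoid" where
  "dual_group S = \<lparr>carrier = {f \<in> S \<rightarrow>\<^sub>E UNIV.
       (\<forall>x\<in>S. \<forall>y\<in>S. f (x + y) = f x + f y) \<and> (\<forall>c. \<forall>x\<in>S. f (c *s x) = c * f x)},
     monoid.mult = (\<lambda>f g. \<lambda>r\<in>S. f r + g r), one = (\<lambda>r\<in>S. 0)\<rparr>"

definition edge_line :: "nat \<Rightarrow> (nat \<Rightarrow> int^3) \<Rightarrow> nat \<Rightarrow> ('k::field_char_0^3) set" where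
  "edge_line n a j =
     vec.span {(if lattice_length (edge n a j) \<ge> 2 then 1 else 0) *s base_change (edge n a j)}"

definition edge_coset :: "nat \<Rightarrow> (nat \<Rightarrow> int^3) \<Rightarrow> nat \<Rightarrow> 'k::field_char_0^3 \<Rightarrow> ('k^3) set" where
  "edge_coset n a j v = edge_line n a j #>\<^bsub>vector_group\<^esub> v"

definition quotient_sum :: "nat \<Rightarrow> (nat \<Rightarrow> int^3) \<Rightarrow> (nat \<Rightarrow> ('k::field_char_0^3) set) monoid" where
  "quotient_sum n a = product_group {1..n} (\<lambda>j. vector_group Mod edge_line n a j)"

definition delta_map ::
  "nat \<Rightarrow> (nat \<Rightarrow> int^3) \<Rightarrow> (nat \<Rightarrow> 'k::field_char_0^3) \<Rightarrow> (nat \<Rightarrow> ('k^3) set)" where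
  "delta_map n a b = (\<lambda>j\<in>{1..n}. edge_coset n a j (b j - b (next_index n j)))"

text \<open>
  A coset \<open>q j\<close> is evaluated at \<open>r\<close> through any representative: \<open>the_elem\<close> extracts the common
  value of \<open>\<langle>v, r\<rangle>\<close> for \<open>v \<in> q j\<close> (see \<open>edge_coset_eval\<close> below).
\<close>

definition eta_map ::
  "(real^3) set \<Rightarrow> nat \<Rightarrow> (nat \<Rightarrow> int^3) \<Rightarrow> (nat \<Rightarrow> ('k::field_char_0^3) set) \<Rightarrow> ('k^3 \<Rightarrow> 'k)" where
  "eta_map P n a q =
     (\<lambda>r \<in> K_span P n a. \<Sum>j=1..n. the_elem ((\<lambda>v. scalar_product v r) ` q j))"

definition ker_eta ::
  "(real^3) set \<Rightarrow> nat \<Rightarrow> (nat \<Rightarrow> int^3) \<Rightarrow> (nat \<Rightarrow> ('k::field_char_0^3) set) set" where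
  "ker_eta P n a = kernel (quotient_sum n a) (dual_group (K_span P n a)) (eta_map P n a)"

definition im_delta :: "nat \<Rightarrow> (nat \<Rightarrow> int^3) \<Rightarrow> (nat \<Rightarrow> ('k::field_char_0^3) set) set" where
  "im_delta n a = delta_map n a ` ({1..n} \<rightarrow>\<^sub>E UNIV)"

definition ker_group ::
  "(real^3) set \<Rightarrow> nat \<Rightarrow> (nat \<Rightarrow> int^3) \<Rightarrow> (nat \<Rightarrow> ('k::field_char_0^3) set) monoid" where
  "ker_group P n a = (quotient_sum n a)\<lparr>carrier := ker_eta P n a\<rparr>"

definition T2_group ::
  "(real^3) set \<Rightarrow> nat \<Rightarrow> (nat \<Rightarrow> int^3) \<Rightarrow> (nat \<Rightarrow> ('k::field_char_0^3) set) set monoid" where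
  "T2_group P n a = ker_group P n a Mod im_delta n a"

definition cup_product ::
  "(real^3) set \<Rightarrow> nat \<Rightarrow> (nat \<Rightarrow> int^3) \<Rightarrow> (nat \<Rightarrow> 'k::field_char_0) \<Rightarrow> (nat \<Rightarrow> 'k)
     \<Rightarrow> (nat \<Rightarrow> ('k^3) set) set" where
  "cup_product P n a t s = im_delta n a #>\<^bsub>ker_group P n a\<^esub>
     (\<lambda>j\<in>{1..n}. edge_coset n a j ((s j * t j) *s base_change (edge n a j)))"

definition perp :: "int^3 \<Rightarrow> ('k::field_char_0^3) set" where
  "perp v = {r. scalar_product (base_change v) r = 0}"

text \<open>
  For distinct parallel edges \<open>d\<^sub>i\<close>, \<open>d\<^sub>j\<close> the lines \<open>edge_perp n a i\<close> and \<open>edge_perp n a j\<close> of \<open>M\<^sub>k\<close>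
  are different, but they have the same image in \<open>M\<^sub>k / k R\<^sup>*\<close>. Linear combinations of the edges
  vanish at \<open>R\<^sup>*\<close>, so they vanish on one line if and only if they vanish on the other.
\<close>

definition R_star :: "int^3" where
  "R_star = axis 3 1"

definition edge_perp :: "nat \<Rightarrow> (nat \<Rightarrow> int^3) \<Rightarrow> nat \<Rightarrow> ('k::field_char_0^3) set" where
  "edge_perp n a j = perp (a j) \<inter> perp (a (next_index n j))"


subsection \<open>Well-definedness of \<open>\<eta>\<close> and of the cup product\<close>

lemma scalar_product_simps:
  "scalar_product (x + y) z = scalar_product x z + scalar_product y z"
  "scalar_product x (y + z) = scalar_product x y + scalar_product x z"
  "scalar_product (x - y) z = scalar_product x z - scalar_product y z"
  "scalar_product (c *s x) z = c * scalar_product x z"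
  "scalar_product x (c *s z) = c * scalar_product x z"
  "scalar_product 0 z = 0" "scalar_product x 0 = 0"
  for x y z :: "'r::comm_ring_1^3"
  by (simp_all add: scalar_product_def sum_3 algebra_simps)

lemma base_change_diff: "base_change (x - y) = base_change x - base_change y"
  by (simp add: base_change_def vec_eq_iff)

lemma scalar_product_base_change:
  "scalar_product (base_change x) (base_change y :: 'r::comm_ring_1^3) = of_int (scalar_product x y)"
  by (simp add: scalar_product_def base_change_def sum_3)

lemma edge_diff:
  "scalar_product (edge n a j) r = scalar_product (a (next_index n j)) r - scalar_product (a j) r"
  by (simp add: edge_def scalar_product_simps)

lemma next_index_in: "j \<in> {1..n} \<Longrightarrow> next_index n j \<in> {1..n}"
  by (auto simp: next_index_def)

lemma sum_next_index: "(\<Sum>j=1..n. f (next_index n j)) = (\<Sum>j=1..n. f j)"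
  for f :: "nat \<Rightarrow> 'b::comm_monoid_add"
proof -
  have "inj_on (next_index n) {1..n}"
    by (auto simp: inj_on_def next_index_def split: if_splits)
  moreover have "next_index n ` {1..n} \<subseteq> {1..n}" using next_index_in by blast
  ultimately have "bij_betw (next_index n) {1..n} {1..n}"
    by (simp add: bij_betw_def endo_inj_surj)
  then show ?thesis by (rule sum.reindex_bij_betw)
qed

lemma vertex_in_P:
  assumes "cyclic_vertices P n a" "j \<in> {1..n}"
  shows "base_change (a j) extreme_point_of P"
  using assms by (auto simp: cyclic_vertices_def bij_betw_def)

lemma K_values:
  assumes cv: "cyclic_vertices P n a" and j: "j \<in> {1..n}" and r: "r \<in> (\<Inter>j\<in>{1..n}. K_set P (a j))"
  shows "scalar_product (a j) r \<in> {0, 1}"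
proof -
  have "base_change (a j) \<in> P" using vertex_in_P[OF cv j] by (simp add: extreme_point_of_def)
  then have "base_change (a j) \<in> cone hull P" by (simp add: hull_inc)
  moreover have K: "r \<in> K_set P (a j)" using r j by blast
  ultimately have "scalar_product (base_change (a j)) (base_change r :: real^3) \<ge> 0"
    by (auto simp: K_set_def dual_semigroup_def)
  then have "scalar_product (a j) r \<ge> 0" by (simp add: scalar_product_base_change)
  moreover have "scalar_product (a j) r < 2" using K by (simp add: K_set_def)
  ultimately show ?thesis by auto
qed

lemma long_edge_vanishes:
  assumes cv: "cyclic_vertices P n a" and j: "j \<in> {1..n}" and r: "r \<in> (\<Inter>j\<in>{1..n}. K_set P (a j))"
    and long: "lattice_length (edge n a j) \<ge> 2"
  shows "scalar_product (edge n a j) r = 0"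
proof -
  let ?g = "Gcd (range (\<lambda>i. edge n a j $ i))"
  have g: "?g \<ge> 2" using long by (simp add: lattice_length_def)
  have "?g dvd scalar_product (edge n a j) r"
    unfolding scalar_product_def by (intro dvd_sum dvd_mult2 Gcd_dvd) auto
  moreover have "\<bar>scalar_product (edge n a j) r\<bar> \<le> 1"
    using K_values[OF cv j r] K_values[OF cv next_index_in[OF j] r] by (auto simp: edge_diff)
  ultimately show ?thesis
    using g by (smt (verit) zdvd_not_zless dvd_minus_iff)
qed

lemma edge_line_K_span:
  assumes cv: "cyclic_vertices P n a" and j: "j \<in> {1..n}"
    and w: "w \<in> edge_line n a j" and r: "r \<in> K_span P n a"
  shows "scalar_product w r = (0::'k::field_char_0)"
proof -
  let ?d = "(if lattice_length (edge n a j) \<ge> 2 then 1 else 0) *s base_change (edge n a j) :: 'k^3"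
  obtain c where w: "w = c *s ?d"
    using w unfolding edge_line_def vec.span_singleton by blast
  have "scalar_product ?d r = 0"
    using r unfolding K_span_def
  proof (induction rule: vec.span_induct_alt)
    case (step c x y)
    then show ?case
      using long_edge_vanishes[OF cv j]
      by (auto simp: scalar_product_simps scalar_product_base_change)
  qed (simp add: scalar_product_simps)
  then show ?thesis by (simp add: w scalar_product_simps)
qed

lemma edge_coset_eval:
  assumes "cyclic_vertices P n a" "j \<in> {1..n}" "r \<in> K_span P n a"
  shows "the_elem ((\<lambda>w. scalar_product w r) ` edge_coset n a j v) = scalar_product v r"
proof -
  have "0 \<in> edge_line n a j" by (simp add: edge_line_def vec.span_zero)
  then have "(\<lambda>w. scalar_product w r) ` edge_coset n a j v = {scalar_product v r}"
    using edge_line_K_span[OF assms(1,2) _ assms(3)]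
    by (auto simp: edge_coset_def r_coset_def vector_group_def scalar_product_simps image_iff
        intro!: bexI[of _ 0])
  then show ?thesis by simp
qed

lemma eta_map_edge_coset:
  assumes "cyclic_vertices P n a"
  shows "eta_map P n a (\<lambda>j\<in>{1..n}. edge_coset n a j (v j)) =
           (\<lambda>r \<in> K_span P n a. \<Sum>j=1..n. scalar_product (v j) r)"
  unfolding eta_map_def
  using edge_coset_eval[OF assms] by (intro restrict_ext sum.cong) auto

lemma edge_coset_in_quotient_sum:
  "(\<lambda>j\<in>{1..n}. edge_coset n a j (v j)) \<in> carrier (quotient_sum n a)"
  by (auto simp: quotient_sum_def carrier_FactGroup edge_coset_def vector_group_def)

lemma im_delta_subset_ker_eta:
  assumes "cyclic_vertices P n a"
  shows "im_delta n a \<subseteq> ker_eta P n a"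
proof
  fix q :: "nat \<Rightarrow> ('k::field_char_0^3) set"
  assume "q \<in> im_delta n a"
  then obtain b where q: "q = (\<lambda>j\<in>{1..n}. edge_coset n a j (b j - b (next_index n j)))"
    by (auto simp: im_delta_def delta_map_def)
  have "eta_map P n a q = (\<lambda>r \<in> K_span P n a. 0)"
    unfolding q eta_map_edge_coset[OF assms]
    using sum_next_index[of "\<lambda>j. scalar_product (b j) _" n]
    by (intro restrict_ext) (simp add: scalar_product_simps sum_subtractf)
  then show "q \<in> ker_eta P n a"
    using edge_coset_in_quotient_sum by (simp add: ker_eta_def kernel_def dual_group_def q)
qed

lemma scalar_product_inner: "scalar_product x y = x \<bullet> y" for x y :: "real^3"
  by (simp add: scalar_product_def inner_vec_def)

lemma n_ge_3:
  assumes "lattice_polygon P" "cyclic_vertices P n a"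
  shows "n \<ge> 3"
proof -
  let ?E = "{v. v extreme_point_of P}"
  obtain S :: "(int^3) set" where "finite S" "P = convex hull (base_change ` S)"
    using assms(1) unfolding lattice_polygon_def by metis
  then have "P = convex hull ?E" using Krein_Milman_polytope by blast
  then have "aff_dim P = aff_dim ?E" by (metis aff_dim_convex_hull)
  moreover have b: "bij_betw (\<lambda>j. base_change (a j)) {1..n} ?E"
    using assms(2) by (simp add: cyclic_vertices_def)
  then have "finite ?E" using bij_betw_finite by blast
  then have "aff_dim ?E \<le> of_nat (card ?E) - 1" by (rule aff_dim_le_card)
  moreover have "card ?E = n" using bij_betw_same_card[OF b] by simp
  moreover have "aff_dim P = 2" using assms(1) by (simp add: lattice_polygon_def)
  ultimately show ?thesis by linarith
qed

text \<open>
  Since \<open>r\<close> takes only the values 0 and 1 at the vertices, the midpoints of the edges on which it is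
  not constant lie on the segment where \<open>P\<close> meets the plane \<open>r = 1/2\<close>; at most two such edges exist.
\<close>

lemma crossing_edges:
  assumes lp: "lattice_polygon P" and cv: "cyclic_vertices P n a"
    and r: "r \<in> (\<Inter>j\<in>{1..n}. K_set P (a j))"
    and J: "{h, i, j} \<subseteq> {j\<in>{1..n}. scalar_product (edge n a j) r \<noteq> 0}"
  shows "h = i \<or> i = j \<or> j = h"
proof -
  define A where "A l = (base_change (a l) :: real^3)" for l
  define m where "m l = midpoint (A l) (A (next_index n l))" for l
  define E where "E l = closed_segment (A l) (A (next_index n l))" for l
  define R where "R = (base_change r :: real^3)"
  define C where "C = {l\<in>{1..n}. scalar_product (edge n a l) r \<noteq> 0}"
  have val: "R \<bullet> A l = of_int (scalar_product (a l) r)" for l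
    by (metis A_def R_def inner_commute scalar_product_base_change scalar_product_inner)
  have C01: "{R \<bullet> A l, R \<bullet> A (next_index n l)} = {0, 1}" if "l \<in> C" for l
  proof -
    have l: "l \<in> {1..n}" and ne: "scalar_product (a (next_index n l)) r \<noteq> scalar_product (a l) r"
      using that by (auto simp: C_def edge_diff)
    show ?thesis
      using ne K_values[OF cv l r] K_values[OF cv next_index_in[OF l] r] by (auto simp: val)
  qed
  have half: "R \<bullet> m l = 1/2" if "l \<in> C" for l
    using C01[OF that] by (auto simp: m_def midpoint_def inner_add_right doubleton_eq_iff)
  have face: "E l face_of P" if "l \<in> C" for l
    using cv that by (auto simp: cyclic_vertices_def C_def E_def A_def edge_of_def)
  have mE: "m l \<in> E l" for l by (simp add: m_def E_def)
  have mP: "m l \<in> P" if "l \<in> C" for l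
    using face_of_imp_subset[OF face[OF that]] mE by blast
  have uniq: "x = m l" if l: "l \<in> C" and x: "x \<in> E l" "R \<bullet> x = 1/2" for x l
  proof -
    obtain u where u: "x = (1 - u) *\<^sub>R A l + u *\<^sub>R A (next_index n l)"
      using x(1) by (auto simp: E_def in_segment)
    then have "(1 - u) * (R \<bullet> A l) + u * (R \<bullet> A (next_index n l)) = 1/2"
      using x(2) by (simp add: inner_add_right)
    then have "u = 1/2" using C01[OF l] by (auto simp: doubleton_eq_iff)
    then show ?thesis by (simp only: u) (simp add: m_def midpoint_def scaleR_right_distrib)
  qed
  have inj: "A l = A l' \<longleftrightarrow> l = l'" if "l \<in> {1..n}" "l' \<in> {1..n}" for l l'
  proof -
    have "inj_on A {1..n}"
      using cv by (simp add: cyclic_vertices_def bij_betw_def A_def[abs_def])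
    then show ?thesis using that by (simp add: inj_on_eq_iff)
  qed
  have ext: "A l extreme_point_of P" if "l \<in> {1..n}" for l
    using vertex_in_P[OF cv that] by (simp add: A_def)
  have m_inj: "l = l'" if C: "l \<in> C" "l' \<in> C" and m: "m l = m l'" for l l'
  proof -
    have l: "l \<in> {1..n}" "l' \<in> {1..n}" using C by (auto simp: C_def)
    note l2 = next_index_in[OF l(1)] next_index_in[OF l(2)]
    have "A l' \<noteq> A (next_index n l')" using C01[OF C(2)] by auto
    then have "m l \<in> open_segment (A l') (A (next_index n l'))"
      using m by (simp add: m_def)
    moreover have "A l' \<in> P" "A (next_index n l') \<in> P"
      using ext l l2 by (auto simp: extreme_point_of_def)
    ultimately have "A l' \<in> E l" "A (next_index n l') \<in> E l"
      using face_ofD[OF face[OF C(1)]] mE by blast+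
    then have "A l' extreme_point_of E l" "A (next_index n l') extreme_point_of E l"
      using extreme_point_of_face[OF face[OF C(1)]] ext l l2 by auto
    then have "l' \<in> {l, next_index n l}" "next_index n l' \<in> {l, next_index n l}"
      using inj l l2 by (auto simp: E_def extreme_point_of_segment)
    then show ?thesis
      using n_ge_3[OF lp cv] l by (auto simp: next_index_def split: if_splits)
  qed
  have between: "x = y \<or> y = z \<or> z = x"
    if C: "x \<in> C" "y \<in> C" "z \<in> C" and b: "between (m y, m z) (m x)" for x y z
  proof (cases "m x = m y \<or> m x = m z")
    case True
    then show ?thesis using m_inj C by blast
  next
    case False
    then have "m x \<in> open_segment (m y) (m z)"
      using b by (auto simp: between_mem_segment open_segment_def)
    then have "m y \<in> E x"
      using face_ofD[OF face[OF C(1)]] mE mP C by blast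
    then have "m y = m x" using uniq half C by blast
    then show ?thesis using False by simp
  qed
  have hij: "h \<in> C" "i \<in> C" "j \<in> C" using J by (auto simp: C_def)
  let ?H = "affine hull P \<inter> {x. R \<bullet> x = 1/2}"
  have "A h \<in> affine hull P"
    using ext[of h] hij(1) by (auto simp: extreme_point_of_def C_def intro: hull_inc)
  moreover have "R \<bullet> A h \<noteq> 1/2" using C01[OF hij(1)] by (auto simp: doubleton_eq_iff)
  ultimately have "\<not> affine hull P \<subseteq> {x. R \<bullet> x = 1/2}" by auto
  then have "aff_dim ?H \<le> 1"
    using lp aff_dim_affine_Int_hyperplane[OF affine_affine_hull, of P R "1/2"]
    by (auto simp: lattice_polygon_def split: if_splits)
  moreover have "{m h, m i, m j} \<subseteq> ?H"
    using half mP hij by (auto intro: hull_inc)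
  ultimately have "collinear {m h, m i, m j}"
    using aff_dim_subset collinear_aff_dim order_trans by blast
  then show ?thesis
    unfolding collinear_between_cases using between hij by metis
qed

lemma cup_sum_vanishes:
  fixes t s :: "nat \<Rightarrow> 'k::field_char_0"
  assumes lp: "lattice_polygon P" and cv: "cyclic_vertices P n a"
    and t: "t \<in> V_space n a" and s: "s \<in> V_space n a"
    and r: "r \<in> K_span P n a"
  shows "(\<Sum>j=1..n. scalar_product ((s j * t j) *s base_change (edge n a j)) r) = 0"
  using r unfolding K_span_def
proof (induction rule: vec.span_induct_alt)
  case (step c x y)
  then obtain r where r: "r \<in> (\<Inter>j\<in>{1..n}. K_set P (a j))" and x: "x = base_change r" by blast
  define g :: "nat \<Rightarrow> 'k" where "g j = of_int (scalar_product (edge n a j) r)" for j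
  define C where "C = {j\<in>{1..n}. scalar_product (edge n a j) r \<noteq> 0}"
  have V: "(\<Sum>j=1..n. u j * g j) = 0" if u: "u \<in> V_space n a" for u
  proof -
    have "scalar_product (\<Sum>j\<in>J. u j *s base_change (edge n a j)) x = (\<Sum>j\<in>J. u j * g j)"
      if "finite J" for J
      using that by induction
        (simp_all add: scalar_product_simps x g_def scalar_product_base_change)
    from this[of "{1..n}"] show ?thesis using u by (simp add: V_space_def scalar_product_simps)
  qed
  have C: "(\<Sum>j=1..n. u j * g j) = (\<Sum>j\<in>C. u j * g j)" for u
    by (rule sum.mono_neutral_right) (auto simp: C_def g_def)
  have fin: "finite C" by (simp add: C_def)
  have "(\<Sum>j=1..n. 1 * g j) = 0"
    using sum_next_index[of "\<lambda>j. of_int (scalar_product (a j) r) :: 'k" n]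
    by (simp add: g_def edge_diff sum_subtractf)
  then have 1: "(\<Sum>j\<in>C. g j) = 0" using C[of "\<lambda>_. 1"] by simp
  have 2: "(\<Sum>j\<in>C. t j * g j) = 0" "(\<Sum>j\<in>C. s j * g j) = 0" using V t s C by metis+
  have "(\<Sum>j\<in>C. s j * t j * g j) = 0"
  proof (cases "\<exists>i j. C = {i, j} \<and> i \<noteq> j")
    case True
    then obtain i j where ij: "C = {i, j}" "i \<noteq> j" by blast
    then have "g j = - g i" "g i \<noteq> 0"
      using 1 by (auto simp: add_eq_0_iff C_def g_def)
    then have "t i = t j" "s i = s j" using 2 ij by auto
    then show ?thesis using ij \<open>g j = - g i\<close> by simp
  next
    case False
    have "C = {} \<or> (\<exists>i. C = {i})"
    proof (rule ccontr)
      assume *: "\<not> ?thesis"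
      then obtain i where i: "i \<in> C" by blast
      then obtain j where j: "j \<in> C" "j \<noteq> i" using * by blast
      then obtain h where "h \<in> C" "h \<noteq> i" "h \<noteq> j" using False i by blast
      then show False using crossing_edges[OF lp cv r, of h i j] i j by (auto simp: C_def)
    qed
    then show ?thesis using 1 by auto
  qed
  then have "(\<Sum>j=1..n. s j * t j * g j) = 0" using C[of "\<lambda>j. s j * t j"] by simp
  then have "(\<Sum>j=1..n. scalar_product ((s j * t j) *s base_change (edge n a j)) x) = 0"
    by (simp add: x g_def scalar_product_simps scalar_product_base_change)
  then show ?case
    using step.IH by (simp add: scalar_product_simps(2,5) sum.distrib flip: sum_distrib_left)
qed (simp add: scalar_product_simps)

lemma cup_product_in_T2_group:
  assumes "lattice_polygon P" "cyclic_vertices P n a" "t \<in> V_space n a" "s \<in> V_space n a"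
  shows "cup_product P n a t s \<in> carrier (T2_group P n a)"
proof -
  let ?q = "\<lambda>j\<in>{1..n}. edge_coset n a j ((s j * t j) *s base_change (edge n a j))"
  have "eta_map P n a ?q = (\<lambda>r \<in> K_span P n a. 0)"
    unfolding eta_map_edge_coset[OF assms(2)]
    using cup_sum_vanishes[OF assms] by (intro restrict_ext) auto
  then have "?q \<in> ker_eta P n a"
    using edge_coset_in_quotient_sum by (simp add: ker_eta_def kernel_def dual_group_def)
  then show ?thesis
    by (auto simp: T2_group_def carrier_FactGroup cup_product_def ker_group_def)
qed

end

theory Submission
  imports Defs
begin

text \<open>
  A cycle of elements \<open>v\<^sub>1,\<dots>,v\<^sub>n\<close> of \<open>N\<^sub>k\<close> is a cycle of consecutive differences
  \<open>b\<^sub>j - b\<^sub>j\<^sub>+\<^sub>1\<close> if and only if its total is zero: then the negated partial sums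
  can serve as \<open>b\<close>.
  Modulo the lines \<open>k \<delta>\<^sub>j d\<^sub>j\<close> each \<open>v\<^sub>j\<close> may be changed by an arbitrary multiple of \<open>d\<^sub>j\<close> if the
  \<open>j\<close>-th edge is long (of lattice length at least 2), and not at all otherwise. Hence the class of
  \<open>v\<close> lies in \<open>im \<delta>\<close> if and only if its total lies in the span of the long edges
  (\<open>edge_class_in_im_delta_iff\<close>); the total of the cup product is
  \<open>E = \<Sum> t\<^sub>j s\<^sub>j d\<^sub>j\<close> (\<open>cup_vanishes_iff\<close>).

  The cases of the theorem are the possible dimensions of this span. Since all vertices have
  height 1, all edges and \<open>E\<close> lie in the plane of height 0. Without long edges the span is zero; with
  two independent long edges it is this whole plane, so the cup product vanishes. If it is a line
  \<open>k d\<^sub>j\<close>, it consists of the vectors of height 0 in the span of \<open>a\<^sub>j\<close> and \<open>a\<^sub>j\<^sub>+\<^sub>1\<close>, that is, of those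
  that vanish on \<open>a\<^sub>j\<^sup>\<bottom> \<inter> a\<^sub>j\<^sub>+\<^sub>1\<^sup>\<bottom>\<close> (\<open>vanishes_on_edge_perp_iff\<close>).
\<close>

section \<open>Vanishing in the cokernel of \<open>\<delta>\<close>\<close>

definition edge_class ::
  "nat \<Rightarrow> (nat \<Rightarrow> int^3) \<Rightarrow> (nat \<Rightarrow> 'k::field_char_0^3) \<Rightarrow> (nat \<Rightarrow> ('k^3) set)" where
  "edge_class n a v = (\<lambda>j\<in>{1..n}. edge_coset n a j (v j))"

definition long_edges :: "nat \<Rightarrow> (nat \<Rightarrow> int^3) \<Rightarrow> ('k::field_char_0^3) set" where
  "long_edges n a = (\<lambda>j. base_change (edge n a j)) ` {j\<in>{1..n}. lattice_length (edge n a j) \<ge> 2}"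

lemma subspace_edge_line: "vec.subspace (edge_line n a j)"
  by (simp add: edge_line_def vec.subspace_span)

lemma mem_edge_coset: "x \<in> edge_coset n a j v \<longleftrightarrow> x - v \<in> edge_line n a j"
  by (force simp: edge_coset_def r_coset_def vector_group_def)

lemma edge_coset_eq_iff: "edge_coset n a j v = edge_coset n a j w \<longleftrightarrow> v - w \<in> edge_line n a j"
proof
  assume "edge_coset n a j v = edge_coset n a j w"
  moreover have "v \<in> edge_coset n a j v"
    by (simp add: mem_edge_coset vec.subspace_0[OF subspace_edge_line])
  ultimately show "v - w \<in> edge_line n a j" by (simp add: mem_edge_coset)
next
  assume *: "v - w \<in> edge_line n a j"
  have "x - v \<in> edge_line n a j \<longleftrightarrow> x - w \<in> edge_line n a j" for x
    using vec.subspace_add[OF subspace_edge_line _ *, of "x - v"]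
      vec.subspace_diff[OF subspace_edge_line _ *, of "x - w"] by auto
  then show "edge_coset n a j v = edge_coset n a j w" by (auto simp: mem_edge_coset)
qed

lemma edge_coset_mult:
  "edge_coset n a j v <#>\<^bsub>vector_group\<^esub> edge_coset n a j w = edge_coset n a j (v + w)"
proof (intro equalityI subsetI)
  fix x
  assume "x \<in> edge_coset n a j v <#>\<^bsub>vector_group\<^esub> edge_coset n a j w"
  then obtain y z where "x = y + z" "y - v \<in> edge_line n a j" "z - w \<in> edge_line n a j"
    by (auto simp: set_mult_def vector_group_def mem_edge_coset)
  then show "x \<in> edge_coset n a j (v + w)"
    using vec.subspace_add[OF subspace_edge_line, of "y - v" n a j "z - w"]
    by (simp add: mem_edge_coset algebra_simps)
next
  fix x
  assume "x \<in> edge_coset n a j (v + w)"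
  then have "x - w \<in> edge_coset n a j v" "w \<in> edge_coset n a j w"
    by (simp_all add: mem_edge_coset algebra_simps vec.subspace_0[OF subspace_edge_line])
  moreover have "x = (x - w) + w" by simp
  ultimately show "x \<in> edge_coset n a j v <#>\<^bsub>vector_group\<^esub> edge_coset n a j w"
    unfolding set_mult_def vector_group_def by fastforce
qed

lemma edge_class_mult:
  "edge_class n a v \<otimes>\<^bsub>ker_group P n a\<^esub> edge_class n a w = edge_class n a (\<lambda>j. v j + w j)"
  by (simp add: ker_group_def quotient_sum_def edge_class_def FactGroup_def edge_coset_mult
      cong: restrict_cong)

lemma edge_class_eq_iff:
  "edge_class n a v = edge_class n a w \<longleftrightarrow> (\<forall>j\<in>{1..n}. v j - w j \<in> edge_line n a j)"
  by (auto simp: edge_class_def restrict_def fun_eq_iff edge_coset_eq_iff)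

lemma im_delta_eq:
  "im_delta n a = range (\<lambda>b. edge_class n a (\<lambda>j. b j - b (next_index n j)))"
proof -
  have "edge_class n a (\<lambda>j. b j - b (next_index n j)) \<in> im_delta n a" for b :: "nat \<Rightarrow> 'a^3"
    unfolding im_delta_def
    by (rule image_eqI[of _ _ "restrict b {1..n}"])
      (use next_index_in in \<open>simp_all add: delta_map_def edge_class_def restrict_apply' cong: restrict_cong\<close>)
  then show ?thesis by (auto simp: im_delta_def delta_map_def edge_class_def)
qed

text \<open>
  Only two properties of \<open>im \<delta>\<close> matter: it contains the neutral class and is invariant under
  translation by its elements.
\<close>

lemma im_delta_coset_eq_iff:
  "im_delta n a #>\<^bsub>ker_group P n a\<^esub> edge_class n a v = im_delta n a \<longleftrightarrow> edge_class n a v \<in> im_delta n a"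
  (is "?C = _ \<longleftrightarrow> _")
proof -
  define D :: "(nat \<Rightarrow> 'a^3) \<Rightarrow> nat \<Rightarrow> 'a^3" where "D b j = b j - b (next_index n j)" for b j
  have im: "im_delta n a = range (\<lambda>b. edge_class n a (D b))"
    by (simp add: im_delta_eq D_def[abs_def])
  have C: "?C = range (\<lambda>b. edge_class n a (\<lambda>j. D b j + v j))"
    by (auto simp: im r_coset_def edge_class_mult)
  show ?thesis
  proof
    have "edge_class n a (\<lambda>j. D (\<lambda>_. 0) j + v j) \<in> ?C" unfolding C by blast
    moreover assume "?C = im_delta n a"
    ultimately show "edge_class n a v \<in> im_delta n a" by (simp add: D_def)
  next
    assume "edge_class n a v \<in> im_delta n a"
    then obtain b where b: "edge_class n a v = edge_class n a (D b)" by (auto simp: im)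
    have "edge_class n a (\<lambda>j. D c j + v j) = edge_class n a (D (\<lambda>j. c j + b j))" for c
      using b by (simp add: edge_class_eq_iff D_def algebra_simps)
    then have "?C = range (\<lambda>c. edge_class n a (D (\<lambda>j. c j + b j)))" by (simp add: C)
    also have "\<dots> = im_delta n a"
    proof -
      \<comment> \<open>translation by \<open>b\<close> permutes the tuples\<close>
      have "edge_class n a (D c) \<in> range (\<lambda>c. edge_class n a (D (\<lambda>j. c j + b j)))" for c
        by (rule image_eqI[of _ _ "\<lambda>j. c j - b j"]) simp_all
      then show ?thesis by (auto simp: im)
    qed
    finally show "?C = im_delta n a" .
  qed
qed

text \<open>
  Summation around the cycle telescopes. Conversely the negated partial sums solve all equations
  but the last one, which closes the cycle and is the vanishing of the total.
\<close>

lemma cyclic_difference_iff: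
  fixes w :: "nat \<Rightarrow> 'b::ab_group_add"
  shows "(\<exists>b. \<forall>j\<in>{1..n}. b j - b (next_index n j) = w j) \<longleftrightarrow> (\<Sum>j=1..n. w j) = 0"
proof
  assume "\<exists>b. \<forall>j\<in>{1..n}. b j - b (next_index n j) = w j"
  then obtain b where "\<forall>j\<in>{1..n}. b j - b (next_index n j) = w j" by blast
  then have "(\<Sum>j=1..n. w j) = (\<Sum>j=1..n. b j - b (next_index n j))" by (intro sum.cong) auto
  then show "(\<Sum>j=1..n. w j) = 0" by (simp only: sum_subtractf sum_next_index diff_self)
next
  assume 0: "(\<Sum>j=1..n. w j) = 0"
  define b where "b j = - (\<Sum>i=1..<j. w i)" for j
  have step: "b j - b (Suc j) = w j" if "j \<ge> 1" for j using that by (simp add: b_def)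
  have "b (Suc n) = b 1" using 0 by (simp add: b_def atLeastLessThanSuc_atLeastAtMost)
  then have "b j - b (next_index n j) = w j" if "j \<in> {1..n}" for j
    using that step[of j] by (auto simp: next_index_def)
  then show "\<exists>b. \<forall>j\<in>{1..n}. b j - b (next_index n j) = w j" by blast
qed

lemma edge_line_cases:
  "edge_line n a j =
     (if lattice_length (edge n a j) \<ge> 2 then vec.span {base_change (edge n a j)} else {0})"
  by (simp add: edge_line_def)

lemma in_span_long_edges_iff:
  "x \<in> vec.span (long_edges n a) \<longleftrightarrow>
     (\<exists>l. (\<forall>j\<in>{1..n}. l j \<in> edge_line n a j) \<and> x = (\<Sum>j=1..n. l j))"
proof
  assume "x \<in> vec.span (long_edges n a)"
  then show "\<exists>l. (\<forall>j\<in>{1..n}. l j \<in> edge_line n a j) \<and> x = (\<Sum>j=1..n. l j)"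
  proof (induction rule: vec.span_induct_alt)
    case base
    show ?case by (rule exI[of _ "\<lambda>_. 0"]) (simp add: vec.subspace_0[OF subspace_edge_line])
  next
    case (step c x y)
    then obtain l where l: "\<forall>j\<in>{1..n}. l j \<in> edge_line n a j" "y = (\<Sum>j=1..n. l j)" by blast
    obtain i where i: "i \<in> {1..n}" "lattice_length (edge n a i) \<ge> 2" "x = base_change (edge n a i)"
      using step(1) unfolding long_edges_def by blast
    then have x: "x \<in> edge_line n a i" by (simp add: edge_line_cases vec.span_base)
    define l' where "l' j = (if j = i then c *s x else 0) + l j" for j
    have "\<forall>j\<in>{1..n}. l' j \<in> edge_line n a j"
      using l(1) x by (simp add: l'_def vec.subspace_add vec.subspace_scale subspace_edge_line)
    moreover have "c *s x + y = (\<Sum>j=1..n. l' j)"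
      using i(1) by (simp add: l'_def l(2) sum.distrib)
    ultimately show ?case by blast
  qed
next
  assume "\<exists>l. (\<forall>j\<in>{1..n}. l j \<in> edge_line n a j) \<and> x = (\<Sum>j=1..n. l j)"
  then obtain l where l: "\<forall>j\<in>{1..n}. l j \<in> edge_line n a j" "x = (\<Sum>j=1..n. l j)" by blast
  have "edge_line n a j \<subseteq> vec.span (long_edges n a)" if "j \<in> {1..n}" for j
    using that by (auto simp: edge_line_cases long_edges_def vec.span_zero
        elim!: set_mp[OF vec.span_mono, rotated])
  then show "x \<in> vec.span (long_edges n a)" unfolding l(2) using l(1) by (intro vec.span_sum) blast
qed

text \<open>
  Representatives may be corrected along the long edges, so the class lies in \<open>im \<delta>\<close> as soon as
  the total can be corrected to zero.
\<close>

lemma edge_class_in_im_delta_iff: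
  "edge_class n a v \<in> im_delta n a \<longleftrightarrow> (\<Sum>j=1..n. v j) \<in> vec.span (long_edges n a)"
proof -
  have "edge_class n a v \<in> im_delta n a \<longleftrightarrow>
      (\<exists>b. \<forall>j\<in>{1..n}. v j - (b j - b (next_index n j)) \<in> edge_line n a j)"
    by (simp add: im_delta_eq edge_class_eq_iff image_iff)
  also have "\<dots> \<longleftrightarrow> (\<exists>l. (\<forall>j\<in>{1..n}. l j \<in> edge_line n a j) \<and>
      (\<exists>b. \<forall>j\<in>{1..n}. b j - b (next_index n j) = v j - l j))"
  proof safe
    fix b assume "\<forall>j\<in>{1..n}. v j - (b j - b (next_index n j)) \<in> edge_line n a j"
    then show "\<exists>l. (\<forall>j\<in>{1..n}. l j \<in> edge_line n a j) \<and>
        (\<exists>b. \<forall>j\<in>{1..n}. b j - b (next_index n j) = v j - l j)"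
      by (intro exI[of _ "\<lambda>j. v j - (b j - b (next_index n j))"] conjI exI[of _ b]) auto
  next
    fix l b
    assume "\<forall>j\<in>{1..n}. l j \<in> edge_line n a j" "\<forall>j\<in>{1..n}. b j - b (next_index n j) = v j - l j"
    then show "\<exists>b. \<forall>j\<in>{1..n}. v j - (b j - b (next_index n j)) \<in> edge_line n a j"
      by (intro exI[of _ b]) simp
  qed
  also have "\<dots> \<longleftrightarrow> (\<exists>l. (\<forall>j\<in>{1..n}. l j \<in> edge_line n a j) \<and> (\<Sum>j=1..n. v j) = (\<Sum>j=1..n. l j))"
    by (simp only: cyclic_difference_iff sum_subtractf right_minus_eq)
  finally show ?thesis by (simp add: in_span_long_edges_iff)
qed

lemma cup_vanishes_iff:
  fixes t s :: "nat \<Rightarrow> 'k::field_char_0"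
  shows "cup_product P n a t s = \<one>\<^bsub>T2_group P n a\<^esub> \<longleftrightarrow>
    (\<Sum>j=1..n. (t j * s j) *s base_change (edge n a j)) \<in> vec.span (long_edges n a :: ('k^3) set)"
proof -
  have "cup_product P n a t s = im_delta n a #>\<^bsub>ker_group P n a\<^esub>
      edge_class n a (\<lambda>j. (t j * s j) *s base_change (edge n a j))"
    by (simp add: cup_product_def edge_class_def mult.commute)
  moreover have "\<one>\<^bsub>T2_group P n a\<^esub> = (im_delta n a :: (nat \<Rightarrow> ('k^3) set) set)"
    by (simp add: T2_group_def FactGroup_def)
  ultimately show ?thesis by (simp add: im_delta_coset_eq_iff edge_class_in_im_delta_iff)
qed

section \<open>Linear algebra in the plane of height 0\<close>

lemma base_change_eq_0_iff:
  "base_change d = (0 :: 'r::{ring_1,ring_char_0}^3) \<longleftrightarrow> d = 0"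
  by (auto simp: base_change_def vec_eq_iff)

lemma vertex_height:
  assumes lp: "lattice_polygon P" and cv: "cyclic_vertices P n a" and j: "j \<in> {1..n}"
  shows "a j $ 3 = 1"
proof -
  obtain S :: "(int^3) set" where S: "\<forall>v\<in>S. v $ 3 = 1" "P = convex hull (base_change ` S)"
    using lp unfolding lattice_polygon_def by metis
  have "base_change (a j) \<in> (base_change ` S :: (real^3) set)"
    using vertex_in_P[OF cv j] extreme_point_of_convex_hull unfolding S(2) by blast
  then obtain v where v: "v \<in> S" "base_change (a j) = (base_change v :: real^3)" by blast
  then have "(base_change (a j) :: real^3) $ 3 = base_change v $ 3" by simp
  then show ?thesis using v(1) S(1) by (simp add: base_change_def)
qed

lemma edge_height:
  assumes "lattice_polygon P" "cyclic_vertices P n a" "j \<in> {1..n}"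
  shows "edge n a j $ 3 = 0"
  using vertex_height[OF assms(1,2)] assms(3) next_index_in[OF assms(3)] by (simp add: edge_def)

lemma long_edge_nonzero: "lattice_length d > 1 \<Longrightarrow> d \<noteq> 0"
  by (auto simp: lattice_length_def)

lemma in_span_planar_iff:
  fixes x d :: "'k::field^3"
  assumes "x $ 3 = 0" "d $ 3 = 0" "d \<noteq> 0"
  shows "x \<in> vec.span {d} \<longleftrightarrow> x $ 1 * d $ 2 = x $ 2 * d $ 1"
proof
  assume "x \<in> vec.span {d}"
  then show "x $ 1 * d $ 2 = x $ 2 * d $ 1" by (auto simp: vec.span_singleton)
next
  assume eq: "x $ 1 * d $ 2 = x $ 2 * d $ 1"
  have "d $ 1 \<noteq> 0 \<or> d $ 2 \<noteq> 0" using assms by (auto simp: vec_eq_iff forall_3)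
  then have "x = (x $ 1 / d $ 1) *s d \<or> x = (x $ 2 / d $ 2) *s d"
    using eq assms by (auto simp: vec_eq_iff forall_3 field_simps)
  then show "x \<in> vec.span {d}" by (auto simp: vec.span_singleton)
qed

lemma in_span_pair_planar:
  fixes x d e :: "'k::field^3"
  assumes "x $ 3 = 0" "d $ 3 = 0" "e $ 3 = 0" and det: "e $ 1 * d $ 2 \<noteq> e $ 2 * d $ 1"
  shows "x \<in> vec.span {e, d}"
proof -
  define D where "D = e $ 1 * d $ 2 - e $ 2 * d $ 1"
  have "D \<noteq> 0" using det by (simp add: D_def)
  \<comment> \<open>Cramer's rule\<close>
  moreover have "D *s x = (x $ 1 * d $ 2 - x $ 2 * d $ 1) *s e + (e $ 1 * x $ 2 - e $ 2 * x $ 1) *s d"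
    using assms(1-3) by (simp add: vec_eq_iff forall_3 D_def algebra_simps)
  then have "D *s x \<in> vec.span {e, d}"
    by (simp only:) (intro vec.span_add vec.span_scale vec.span_base, auto)
  ultimately show ?thesis using vec.span_scale[of "D *s x" _ "inverse D"] by simp
qed

text \<open>
  Collinearity is tested over the reals, but for planar integer vectors it is an integral
  equation, which can be read over every field of characteristic 0.
\<close>

lemma parallel_planar_iff:
  assumes "d $ 3 = 0" "e $ 3 = 0" "e \<noteq> 0"
  shows "parallel d e \<longleftrightarrow> d $ 1 * e $ 2 = d $ 2 * e $ 1"
proof -
  have "parallel d e \<longleftrightarrow> collinear {0, base_change e :: real^3, base_change d}"
    by (simp add: parallel_def insert_commute)
  also have "\<dots> \<longleftrightarrow> (base_change d :: real^3) \<in> vec.span {base_change e}"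
    using assms(3) unfolding collinear_lemma vec.span_singleton
    by (auto simp: base_change_eq_0_iff scalar_mult_eq_scaleR intro: range_eqI[of _ _ 0])
  also have "\<dots> \<longleftrightarrow> real_of_int (d $ 1 * e $ 2) = real_of_int (d $ 2 * e $ 1)"
    using assms by (subst in_span_planar_iff) (auto simp: base_change_eq_0_iff, auto simp: base_change_def)
  finally show ?thesis by (simp only: of_int_eq_iff)
qed

lemma mem_edge_perp_iff:
  "r \<in> edge_perp n a j \<longleftrightarrow> scalar_product (base_change (a j)) r = 0 \<and>
     scalar_product (base_change (edge n a j)) r = 0"
  by (auto simp: edge_perp_def perp_def edge_def base_change_diff scalar_product_simps)

text \<open>
  Duality for a line in the plane: \<open>edge_perp\<close> is itself a line, spanned by \<open>d\<^sub>j\<close> rotated through a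
  right angle and lifted into \<open>a\<^sub>j\<^sup>\<bottom>\<close>; for height 0 the lift does not change the pairing.
\<close>

lemma vanishes_on_edge_perp_iff:
  fixes x :: "'k::field_char_0^3"
  assumes "a j $ 3 = 1" "edge n a j $ 3 = 0" "edge n a j \<noteq> 0" "x $ 3 = 0"
  shows "(\<forall>r\<in>edge_perp n a j. scalar_product x r = 0) \<longleftrightarrow> x \<in> vec.span {base_change (edge n a j)}"
proof
  assume "x \<in> vec.span {base_change (edge n a j)}"
  then show "\<forall>r\<in>edge_perp n a j. scalar_product x r = 0"
    by (auto simp: vec.span_singleton mem_edge_perp_iff scalar_product_simps)
next
  assume van: "\<forall>r\<in>edge_perp n a j. scalar_product x r = 0"
  define d A where "d = (base_change (edge n a j) :: 'k^3)" and "A = (base_change (a j) :: 'k^3)"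
  have h: "d $ 3 = 0" "A $ 3 = 1" "d \<noteq> 0"
    using assms by (auto simp: d_def A_def base_change_eq_0_iff, auto simp: base_change_def)
  define r :: "'k^3" where "r = vector [d $ 2, - d $ 1, A $ 2 * d $ 1 - A $ 1 * d $ 2]"
  have "r \<in> edge_perp n a j"
    using h by (simp add: mem_edge_perp_iff flip: d_def A_def)
      (simp add: r_def scalar_product_def sum_3 algebra_simps)
  then have "scalar_product x r = 0" using van by blast
  then have "x $ 1 * d $ 2 = x $ 2 * d $ 1"
    using assms(4) by (simp add: r_def scalar_product_def sum_3 algebra_simps)
  then show "x \<in> vec.span {base_change (edge n a j)}"
    using in_span_planar_iff[OF assms(4) h(1,3)] by (simp add: d_def)
qed

text \<open>
  Subtracting \<open>\<langle>a\<^sub>j, r\<rangle> R\<^sup>*\<close> moves every \<open>r \<in> d\<^sub>j\<^sup>\<bottom>\<close> into \<open>edge_perp\<close>. So modulo \<open>R\<^sup>*\<close> the line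
  \<open>edge_perp\<close> depends only on the direction of the edge and agrees for parallel edges.
\<close>

lemma edge_perp_plus_R_star:
  assumes "a j $ 3 = 1" "edge n a j $ 3 = 0"
  shows "edge_perp n a j + vec.span {base_change R_star :: 'k::field_char_0^3} = perp (edge n a j)"
proof -
  have R: "scalar_product y (base_change R_star) = y $ 3" for y :: "'k^3"
    by (simp add: scalar_product_def sum_3 base_change_def R_star_def axis_def)
  have h: "base_change (a j) $ 3 = (1::'k)" "base_change (edge n a j) $ 3 = (0::'k)"
    using assms by (simp_all add: base_change_def)
  show ?thesis
  proof (intro equalityI subsetI)
    fix x :: "'k^3"
    assume "x \<in> edge_perp n a j + vec.span {base_change R_star}"
    then show "x \<in> perp (edge n a j)"
      by (auto simp: set_plus_def vec.span_singleton mem_edge_perp_iff perp_def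
          scalar_product_simps R h)
  next
    fix x :: "'k^3"
    assume x: "x \<in> perp (edge n a j)"
    define c where "c = scalar_product (base_change (a j)) x"
    have "scalar_product y (x - c *s base_change R_star) = scalar_product y x - c * y $ 3" for y
      by (metis R add_diff_cancel diff_add_cancel scalar_product_simps(2,5))
    then have "x - c *s base_change R_star \<in> edge_perp n a j"
      using x by (simp add: mem_edge_perp_iff perp_def h c_def)
    moreover have "c *s base_change R_star \<in> vec.span {base_change R_star :: 'k^3}"
      by (auto simp: vec.span_singleton)
    moreover have "x = (x - c *s base_change R_star) + c *s base_change R_star" by simp
    ultimately show "x \<in> edge_perp n a j + vec.span {base_change R_star}"
      by (metis set_plus_intro)
  qed
qed

lemma perp_subset_of_in_span:
  assumes "base_change e \<in> vec.span {base_change d :: 'k::field_char_0^3}"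
  shows "perp d \<subseteq> (perp e :: ('k^3) set)"
  using assms by (auto simp: perp_def vec.span_singleton scalar_product_simps)

section \<open>Vanishing of the cup product by types of long edges\<close>

theorem corollary4p6:
  fixes P :: "(real^3) set" and n :: nat and a :: "nat \<Rightarrow> int^3"
    and t s :: "nat \<Rightarrow> 'k::field_char_0"
  assumes "lattice_polygon P" and "cyclic_vertices P n a"
    and "t \<in> V_space n a" and "s \<in> V_space n a"
  shows
    "let cup_vanishes = (cup_product P n a t s = \<one>\<^bsub>T2_group P n a\<^esub>);
         E = (\<Sum>j=1..n. (t j * s j) *s base_change (edge n a j)) :: 'k^3
     in
       ((\<forall>j\<in>{1..n}. lattice_length (edge n a j) = 1) \<longrightarrow>
          (cup_vanishes \<longleftrightarrow> E = 0)) \<and>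
       (\<forall>j\<in>{1..n}. lattice_length (edge n a j) > 1 \<and>
            (\<forall>k\<in>{1..n} - {j}. lattice_length (edge n a k) = 1) \<longrightarrow>
          (cup_vanishes \<longleftrightarrow> (\<forall>r\<in>edge_perp n a j. scalar_product E r = 0))) \<and>
       (\<forall>j\<in>{1..n}. \<forall>i\<in>{1..n} - {j}.
            lattice_length (edge n a j) > 1 \<and> lattice_length (edge n a i) > 1 \<and>
            parallel (edge n a i) (edge n a j) \<and>
            (\<forall>k\<in>{1..n} - {i, j}. lattice_length (edge n a k) = 1) \<longrightarrow>
          (cup_vanishes \<longleftrightarrow> (\<forall>r\<in>edge_perp n a j. scalar_product E r = 0)) \<and>
          (cup_vanishes \<longleftrightarrow> (\<forall>r\<in>edge_perp n a i. scalar_product E r = 0)) \<and>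
          (edge_perp n a j :: ('k^3) set) + vec.span {base_change R_star} =
            edge_perp n a i + vec.span {base_change R_star}) \<and>
       ((\<exists>i\<in>{1..n}. \<exists>j\<in>{1..n}. lattice_length (edge n a i) \<ge> 2 \<and>
            lattice_length (edge n a j) \<ge> 2 \<and> \<not> parallel (edge n a i) (edge n a j)) \<longrightarrow>
          cup_vanishes)"
proof -
  note lp = assms(1) and cv = assms(2)
  note height = vertex_height[OF lp cv] edge_height[OF lp cv]
  define E where "E = (\<Sum>j=1..n. (t j * s j) *s base_change (edge n a j) :: 'k^3)"
  have E3: "E $ 3 = 0"
    using height(2) by (simp add: E_def sum_component base_change_def)
  have cup: "cup_product P n a t s = \<one>\<^bsub>T2_group P n a\<^esub> \<longleftrightarrow> E \<in> vec.span (long_edges n a)"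
    by (simp add: cup_vanishes_iff E_def)
  have dual: "(\<forall>r\<in>edge_perp n a j. scalar_product E r = 0) \<longleftrightarrow>
      E \<in> vec.span {base_change (edge n a j)}"
    if "j \<in> {1..n}" "lattice_length (edge n a j) > 1" for j
    using that by (intro vanishes_on_edge_perp_iff height E3 long_edge_nonzero)
  have 1: "E \<in> vec.span (long_edges n a) \<longleftrightarrow> E = 0"
    if "\<forall>j\<in>{1..n}. lattice_length (edge n a j) = 1"
  proof -
    have "long_edges n a = ({} :: ('k^3) set)" using that by (fastforce simp: long_edges_def)
    then show ?thesis by simp
  qed
  have 2: "E \<in> vec.span (long_edges n a) \<longleftrightarrow> (\<forall>r\<in>edge_perp n a j. scalar_product E r = 0)"
    if j: "j \<in> {1..n}" "lattice_length (edge n a j) > 1"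
      and short: "\<forall>k\<in>{1..n} - {j}. lattice_length (edge n a k) = 1" for j
  proof -
    have "k = j" if "k \<in> {1..n}" "lattice_length (edge n a k) \<ge> 2" for k
      using short[rule_format, of k] that by (cases "k = j") auto
    moreover have "lattice_length (edge n a j) \<ge> 2" using j(2) by simp
    ultimately have "{k\<in>{1..n}. lattice_length (edge n a k) \<ge> 2} = {j}" using j(1) by blast
    then have "long_edges n a = {base_change (edge n a j) :: 'k^3}"
      unfolding long_edges_def by (simp only: image_insert image_empty)
    then show ?thesis using dual[OF j] by simp
  qed
  have 3: "E \<in> vec.span (long_edges n a) \<longleftrightarrow> (\<forall>r\<in>edge_perp n a j. scalar_product E r = 0)"
    "(edge_perp n a j :: ('k^3) set) + vec.span {base_change R_star} =
       edge_perp n a i + vec.span {base_change R_star}"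
    if j: "j \<in> {1..n}" "lattice_length (edge n a j) > 1"
      and i: "i \<in> {1..n}" "lattice_length (edge n a i) > 1"
      and par: "parallel (edge n a i) (edge n a j)"
      and short: "\<forall>k\<in>{1..n} - {i, j}. lattice_length (edge n a k) = 1" for i j
  proof -
    let ?d = "base_change (edge n a j) :: 'k^3" and ?e = "base_change (edge n a i) :: 'k^3"
    have "edge n a i $ 1 * edge n a j $ 2 = edge n a i $ 2 * edge n a j $ 1"
      using par parallel_planar_iff[OF height(2)[OF i(1)] height(2)[OF j(1)]
          long_edge_nonzero[OF j(2)]] by simp
    then have "(of_int (edge n a i $ 1 * edge n a j $ 2) :: 'k) =
        of_int (edge n a i $ 2 * edge n a j $ 1)" by (simp only:)
    then have det: "?e $ 1 * ?d $ 2 = ?e $ 2 * ?d $ 1" by (simp add: base_change_def)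
    have h: "?d $ 3 = 0" "?e $ 3 = 0"
      using height(2) i(1) j(1) by (simp_all add: base_change_def)
    have nz: "?d \<noteq> 0" "?e \<noteq> 0"
      using i(2) j(2) by (simp_all add: base_change_eq_0_iff long_edge_nonzero)
    have ed: "?e \<in> vec.span {?d}" using in_span_planar_iff[OF h(2,1) nz(1)] det by simp
    have de: "?d \<in> vec.span {?e}"
      using in_span_planar_iff[OF h nz(2)] det by (simp add: mult.commute)
    have "k = i \<or> k = j" if "k \<in> {1..n}" "lattice_length (edge n a k) \<ge> 2" for k
      using short[rule_format, of k] that by (cases "k = i \<or> k = j") auto
    moreover have "lattice_length (edge n a j) \<ge> 2" "lattice_length (edge n a i) \<ge> 2"
      using i(2) j(2) by simp_all
    ultimately have "{k\<in>{1..n}. lattice_length (edge n a k) \<ge> 2} = {i, j}"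
      using i(1) j(1) by blast
    then have "long_edges n a = {?e, ?d}"
      unfolding long_edges_def by (simp only: image_insert image_empty)
    then have "vec.span (long_edges n a) = vec.span {?d}"
      using ed by (simp add: vec.span_redundant)
    then show "E \<in> vec.span (long_edges n a) \<longleftrightarrow> (\<forall>r\<in>edge_perp n a j. scalar_product E r = 0)"
      using dual[OF j] by simp
    show "(edge_perp n a j :: ('k^3) set) + vec.span {base_change R_star} =
       edge_perp n a i + vec.span {base_change R_star}"
      using perp_subset_of_in_span[OF ed] perp_subset_of_in_span[OF de] i(1) j(1)
      by (simp add: edge_perp_plus_R_star height)
  qed
  have 4: "E \<in> vec.span (long_edges n a)"
    if i: "i \<in> {1..n}" "lattice_length (edge n a i) \<ge> 2"
      and j: "j \<in> {1..n}" "lattice_length (edge n a j) \<ge> 2"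
      and par: "\<not> parallel (edge n a i) (edge n a j)" for i j
  proof -
    let ?d = "base_change (edge n a j) :: 'k^3" and ?e = "base_change (edge n a i) :: 'k^3"
    have "edge n a i $ 1 * edge n a j $ 2 \<noteq> edge n a i $ 2 * edge n a j $ 1"
      using par parallel_planar_iff[OF height(2)[OF i(1)] height(2)[OF j(1)]
          long_edge_nonzero] j(2) by simp
    then have "(of_int (edge n a i $ 1 * edge n a j $ 2) :: 'k) \<noteq>
        of_int (edge n a i $ 2 * edge n a j $ 1)" by (simp only: of_int_eq_iff not_False_eq_True)
    then have "?e $ 1 * ?d $ 2 \<noteq> ?e $ 2 * ?d $ 1" by (simp add: base_change_def)
    moreover have "?d $ 3 = 0" "?e $ 3 = 0"
      using height(2) i(1) j(1) by (simp_all add: base_change_def)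
    ultimately have "E \<in> vec.span {?e, ?d}" using E3 by (intro in_span_pair_planar)
    moreover have "{?e, ?d} \<subseteq> long_edges n a" using i j by (auto simp: long_edges_def)
    ultimately show ?thesis using vec.span_mono by blast
  qed
  show ?thesis
    unfolding Let_def cup E_def[symmetric]
  proof (intro conjI impI ballI)
    fix i j
    assume ij: "j \<in> {1..n}" "i \<in> {1..n} - {j}"
      and *: "lattice_length (edge n a j) > 1 \<and> lattice_length (edge n a i) > 1 \<and>
        parallel (edge n a i) (edge n a j) \<and>
        (\<forall>k\<in>{1..n} - {i, j}. lattice_length (edge n a k) = 1)"
    then show "E \<in> vec.span (long_edges n a) \<longleftrightarrow> (\<forall>r\<in>edge_perp n a j. scalar_product E r = 0)"
      and "(edge_perp n a j :: ('k^3) set) + vec.span {base_change R_star} =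
        edge_perp n a i + vec.span {base_change R_star}"
      using 3[of j i] by auto
    have "parallel (edge n a j) (edge n a i)"
      using * by (simp add: parallel_def insert_commute)
    then show "E \<in> vec.span (long_edges n a) \<longleftrightarrow> (\<forall>r\<in>edge_perp n a i. scalar_product E r = 0)"
      using 3(1)[of i j] ij * by (auto simp: insert_commute)
  qed (use 1 2 4 in auto)
qed

end
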